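(* For pure global states $\rho_{\bar i}$, the entropy production and entropy flow of the subsystem $S$ at time $t=t_1>0$ are zero in both perspectives (for any given frame orientations $g_i,g_j\in\mathcal G$), $$\Sigma_{\bar i}(t_1)=0=\Sigma_{\bar j}(t_1),\qquad \Phi_{\bar i}(t_1)=0=\Phi_{\bar j}(t_1),\tag{1}$$ if and only if, at the initial time $t_0=0$ and the later time $t_1$, $$\rho_{\bar i}(t_a)=\rho_j(0)\otimes\rho_{S|R_i}(t_a)\in\mathcal A_{\bar i}^{X^a},\tag{2}$$ for some bilocal unitary $X^a=Y_j^0\otimes Z_S^a$, $a=0,1$. For $\rho_{\bar i}$ mixed, (1) holds true if $\rho_{\bar i}(t_a)$, $a=0,1$, satisfy at least one of the following: (i) they obey (2); (ii) they admit pure state decompositions of the form $$\rho_{\bar i}(t_a)=\sum_{A,B}p_A\,q_B^a\,\rho_j^A(0)\otimes\rho_{S|R_i}^B(t_a)$$ with $\rho_j^A(0)\otimes\rho_{S|R_i}^B(t_a)\in\mathcal A_{\bar i}^{X^{AB}}$ for possibly distinct $X^{AB}=Y_j^{A,0}\otimes Z_S^{B,a}$.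
   Context: $\mathcal G$ is a finite abelian group, $\mathcal G\neq\{e\}$. For $i=1,2$ (two ideal quantum reference frames $R_1,R_2$), $\mathcal H_i=\ell^2(\mathcal G)$ has orthonormal basis $\{|g\rangle_i\}_{g\in\mathcal G}$. $\mathcal H_S$ is a finite-dimensional complex Hilbert space carrying a unitary representation $g\mapsto U_S^g$. For $i\neq j$, $\mathcal H_{\bar i}=\mathcal H_j\otimes\mathcal H_S$, $\mathcal A_{\bar i}=\mathcal L(\mathcal H_{\bar i})$. For a unitary $W$: $\hat W(A)=WAW^\dagger$, $\hat W^\dagger(A)=W^\dagger AW$. Frame change: $V_{i\to j}^{g_i,g_j}=\sum_g|gg_i\rangle_i\otimes\langle g_jg^{-1}|_j\otimes U_S^g:\mathcal H_{\bar i}\to\mathcal H_{\bar j}$. Let $\mathbf U_{\bar i}^{g_i,g_j}=\sum_g|g_ig\rangle\langle g_jg^{-1}|_j\otimes U_S^g$. For a bilocal unitary $X=Y_j\otimes Z_S$, $\mathcal A_{\bar i}^X=\{f\in\mathcal A_{\bar i}:\hat{\mathbf U}_{\bar i}^{g_i,g_j}(f)=\hat X^\dagger(f)\}$. The global state $\rho_{\bar i}(t)$ evolves unitarily under a time-independent Hamiltonian on $\mathcal H_{\bar i}$, and $\rho_{\bar j}(t)=\hat V_{i\to j}^{g_i,g_j}(\rho_{\bar i}(t))$. Reduced states: $\rho_j=\mathrm{Tr}_S\rho_{\bar i}$, $\rho_{S|R_i}=\mathrm{Tr}_j\rho_{\bar i}$, $\rho_i=\mathrm{Tr}_S\rho_{\bar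 j}$, $\rho_{S|R_j}=\mathrm{Tr}_i\rho_{\bar j}$. Let $S_{\rm vN}[\rho]=-\mathrm{Tr}(\rho\log\rho)$, $S[\rho\|\sigma]=\mathrm{Tr}(\rho\log\rho-\rho\log\sigma)$ (possibly $+\infty$), and $I[\rho_{\bar i}]=S[\rho_{\bar i}\|\rho_j\otimes\rho_{S|R_i}]$. Entropy production and entropy flow (out of $S$) in $R_i$-perspective are, for initial global states of product form $\rho_{\bar i}(0)=\rho_j(0)\otimes\rho_{S|R_i}(0)$, $$\Sigma_{\bar i}(t)=I[\rho_{\bar i}(t)]+S[\rho_j(t)\|\rho_j(0)],\qquad \Phi_{\bar i}(t)=S_{\rm vN}[\rho_j(t)]-S_{\rm vN}[\rho_j(0)]+S[\rho_j(t)\|\rho_j(0)],$$ and analogously in $R_j$-perspective with $i$ and $j$ exchanged. These notions apply in both perspectives only if the initial state is of product form in both perspectives; (1) includes this requirement. In (ii), $p_A$ and $q_B^a$ are probability weights and $\rho_j^A(0)$, $\rho_{S|R_i}^B(t_a)$ are pure states. *)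

theory Defs
  imports "HOL-Analysis.Analysis"
begin

text \<open>
  A finite-dimensional Hilbert space is \<open>complex^'n\<close> with its standard orthonormal basis, and its
  operators are the matrices \<open>complex^'n^'n\<close>; products of operators are \<open>**\<close> (the pointwise \<open>*\<close> on
  vectors plays no role).  The abelian group is a finite type of class \<open>ab_group_add\<close>, so it is
  written additively.  The kinematical spaces of the two frames are two copies of
  \<open>complex^'g\<close>, and (frame) \<open>\<otimes>\<close> (system) is \<open>complex^('g \<times> 's)\<close>, whichever frame is meant.
\<close>

type_synonym 'n operator = "complex^'n^'n"

section \<open>Operators\<close>

definition adj :: "'n::finite operator \<Rightarrow> 'n operator" where
  "adj A = (\<chi> i j. cnj (A $ j $ i))"

definition hermitian :: "'n::finite operator \<Rightarrow> bool" where
  "hermitian A \<longleftrightarrow> adj A = A"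

definition unitary :: "'n::finite operator \<Rightarrow> bool" where
  "unitary W \<longleftrightarrow> adj W ** W = mat 1 \<and> W ** adj W = mat 1"

definition cinner :: "complex^'n \<Rightarrow> complex^'n \<Rightarrow> complex" where
  "cinner v w = (\<Sum>i\<in>UNIV. cnj (v $ i) * w $ i)"

definition outer :: "complex^'n \<Rightarrow> complex^'n \<Rightarrow> 'n::finite operator" where
  "outer v w = (\<chi> i j. v $ i * cnj (w $ j))"

text \<open>The operator $|g\rangle\langle h|$ of two basis vectors.\<close>

definition ketbra :: "'n \<Rightarrow> 'n \<Rightarrow> 'n::finite operator" where
  "ketbra g h = outer (axis g 1) (axis h 1)"

definition conj_by :: "'n::finite operator \<Rightarrow> 'n operator \<Rightarrow> 'n operator" where
  "conj_by W A = W ** A ** adj W"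

definition tensor :: "'g::finite operator \<Rightarrow> 's::finite operator \<Rightarrow> ('g \<times> 's) operator" where
  "tensor A B = (\<chi> p q. A $ fst p $ fst q * B $ snd p $ snd q)"

text \<open>\<open>ptrace_system\<close> traces out the system, \<open>ptrace_frame\<close> the frame.\<close>

definition ptrace_system :: "('g::finite \<times> 's::finite) operator \<Rightarrow> 'g operator" where
  "ptrace_system R = (\<chi> g h. \<Sum>s\<in>UNIV. R $ (g, s) $ (h, s))"

definition ptrace_frame :: "('g::finite \<times> 's::finite) operator \<Rightarrow> 's operator" where
  "ptrace_frame R = (\<chi> r s. \<Sum>g\<in>UNIV. R $ (g, r) $ (g, s))"

text \<open>
  Functional calculus for a hermitian \<open>A\<close>: the operator acting as \<open>f \<lambda>\<close> on the eigenspace of each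
  eigenvalue \<open>\<lambda>\<close> (which is real, so \<open>Re\<close> only adjusts the type).  It exists and is
  unique because \<open>A\<close> has an orthonormal basis of eigenvectors; the value is
  meaningful for hermitian \<open>A\<close> only.
\<close>

definition op_fun :: "(real \<Rightarrow> complex) \<Rightarrow> 'n::finite operator \<Rightarrow> 'n operator" where
  "op_fun f A = (THE B. \<forall>c v. A *v v = c *s v \<longrightarrow> B *v v = f (Re c) *s v)"

text \<open>The logarithm of a positive operator, taken to be zero on its kernel.\<close>

definition op_log :: "'n::finite operator \<Rightarrow> 'n operator" where
  "op_log = op_fun (\<lambda>x. complex_of_real (if x = 0 then 0 else ln x))"

text \<open>$e^{-\mathrm{i}tH}$, with $\hbar = 1$.\<close>

definition evolution :: "'n::finite operator \<Rightarrow> real \<Rightarrow> 'n operator" where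
  "evolution H t = op_fun (\<lambda>E. exp (- \<i> * complex_of_real (t * E))) H"

section \<open>States and entropies\<close>

definition density_operator :: "'n::finite operator \<Rightarrow> bool" where
  "density_operator R \<longleftrightarrow>
     hermitian R \<and> (\<forall>v. 0 \<le> Re (cinner v (R *v v))) \<and> trace R = 1"

definition pure_state :: "'n::finite operator \<Rightarrow> bool" where
  "pure_state R \<longleftrightarrow> (\<exists>v. norm v = 1 \<and> R = outer v v)"

definition product_state :: "('g::finite \<times> 's::finite) operator \<Rightarrow> bool" where
  "product_state R \<longleftrightarrow> R = tensor (ptrace_system R) (ptrace_frame R)"

text \<open>
  The traces below are real, so \<open>Re\<close> only adjusts the type.  The relative entropy is infinite unless
  the kernel of the second state is contained in that of the first; otherwise the convention
  for \<open>op_log\<close> on kernels is immaterial, as it implements $0 \log 0 = 0$.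
\<close>

definition vN_entropy :: "'n::finite operator \<Rightarrow> real" where
  "vN_entropy R = - Re (trace (R ** op_log R))"

definition rel_entropy :: "'n::finite operator \<Rightarrow> 'n operator \<Rightarrow> ereal" where
  "rel_entropy R S =
     (if \<forall>v. S *v v = 0 \<longrightarrow> R *v v = 0
      then ereal (Re (trace (R ** op_log R - R ** op_log S)))
      else \<infinity>)"

definition mutual_info :: "('g::finite \<times> 's::finite) operator \<Rightarrow> ereal" where
  "mutual_info R = rel_entropy R (tensor (ptrace_system R) (ptrace_frame R))"

text \<open>
  The argument \<open>\<rho>\<close> is the history of the global state in one perspective, so these
  serve for both perspectives.  They are meant for histories with \<open>product_state (\<rho> 0)\<close>.
\<close>

definition entropy_production :: "(real \<Rightarrow> ('g::finite \<times> 's::finite) operator) \<Rightarrow> real \<Rightarrow> ereal" where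
  "entropy_production \<rho> t =
     mutual_info (\<rho> t) + rel_entropy (ptrace_system (\<rho> t)) (ptrace_system (\<rho> 0))"

definition entropy_flow :: "(real \<Rightarrow> ('g::finite \<times> 's::finite) operator) \<Rightarrow> real \<Rightarrow> ereal" where
  "entropy_flow \<rho> t =
     ereal (vN_entropy (ptrace_system (\<rho> t)) - vN_entropy (ptrace_system (\<rho> 0)))
     + rel_entropy (ptrace_system (\<rho> t)) (ptrace_system (\<rho> 0))"

section \<open>Change of quantum reference frame\<close>

definition unitary_rep :: "('g::{finite,ab_group_add} \<Rightarrow> 's::finite operator) \<Rightarrow> bool" where
  "unitary_rep U \<longleftrightarrow> U 0 = mat 1 \<and> (\<forall>g h. U (g + h) = U g ** U h) \<and> (\<forall>g. unitary (U g))"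

text \<open>
  \<open>frame_change\<close> maps (frame \<open>j\<close>) \<open>\<otimes>\<close> (system) to (frame \<open>i\<close>) \<open>\<otimes>\<close> (system), while
  \<open>reorientation\<close> is an operator on (frame \<open>j\<close>) \<open>\<otimes>\<close> (system).  As matrices they agree, since
  both frames are modelled by the same basis.
\<close>

definition frame_change ::
  "('g::{finite,ab_group_add} \<Rightarrow> 's::finite operator) \<Rightarrow> 'g \<Rightarrow> 'g \<Rightarrow> ('g \<times> 's) operator" where
  "frame_change U gi gj = (\<Sum>g\<in>UNIV. tensor (ketbra (g + gi) (gj - g)) (U g))"

definition reorientation ::
  "('g::{finite,ab_group_add} \<Rightarrow> 's::finite operator) \<Rightarrow> 'g \<Rightarrow> 'g \<Rightarrow> ('g \<times> 's) operator" where
  "reorientation U gi gj = (\<Sum>g\<in>UNIV. tensor (ketbra (gi + g) (gj - g)) (U g))"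

definition invariant_algebra ::
  "('g::{finite,ab_group_add} \<Rightarrow> 's::finite operator) \<Rightarrow> 'g \<Rightarrow> 'g \<Rightarrow> ('g \<times> 's) operator
     \<Rightarrow> ('g \<times> 's) operator set" where
  "invariant_algebra U gi gj X = {f. conj_by (reorientation U gi gj) f = conj_by (adj X) f}"

definition other_perspective ::
  "('g::{finite,ab_group_add} \<Rightarrow> 's::finite operator) \<Rightarrow> 'g \<Rightarrow> 'g
     \<Rightarrow> (real \<Rightarrow> ('g \<times> 's) operator) \<Rightarrow> real \<Rightarrow> ('g \<times> 's) operator" where
  "other_perspective U gi gj \<rho> t = conj_by (frame_change U gi gj) (\<rho> t)"

section \<open>The conditions compared\<close>

text \<open>
  Entropy production and flow in both perspectives are only defined if the initial state is of product
  form in both, which is therefore part of the condition.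
\<close>

definition no_exchange ::
  "('g::{finite,ab_group_add} \<Rightarrow> 's::finite operator) \<Rightarrow> 'g \<Rightarrow> 'g
     \<Rightarrow> (real \<Rightarrow> ('g \<times> 's) operator) \<Rightarrow> real \<Rightarrow> bool" where
  "no_exchange U gi gj \<rho> t \<longleftrightarrow>
     (let \<rho>' = other_perspective U gi gj \<rho> in
        product_state (\<rho> 0) \<and> product_state (\<rho>' 0) \<and>
        entropy_production \<rho> t = 0 \<and> entropy_production \<rho>' t = 0 \<and>
        entropy_flow \<rho> t = 0 \<and> entropy_flow \<rho>' t = 0)"

text \<open>The times are \<open>t 0\<close> and \<open>t 1\<close>; the unitary \<open>Y\<close> is the same for both.\<close>

definition invariant_product ::
  "('g::{finite,ab_group_add} \<Rightarrow> 's::finite operator) \<Rightarrow> 'g \<Rightarrow> 'g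
     \<Rightarrow> (real \<Rightarrow> ('g \<times> 's) operator) \<Rightarrow> (nat \<Rightarrow> real) \<Rightarrow> bool" where
  "invariant_product U gi gj \<rho> t \<longleftrightarrow>
     (\<exists>Y Z. unitary Y \<and>
        (\<forall>a\<in>{0, 1}. unitary (Z a) \<and>
           \<rho> (t a) = tensor (ptrace_system (\<rho> 0)) (ptrace_frame (\<rho> (t a))) \<and>
           \<rho> (t a) \<in> invariant_algebra U gi gj (tensor Y (Z a))))"

definition prob_weights :: "nat \<Rightarrow> (nat \<Rightarrow> real) \<Rightarrow> bool" where
  "prob_weights n p \<longleftrightarrow> (\<forall>k<n. 0 \<le> p k) \<and> (\<Sum>k<n. p k) = 1"

definition invariant_decomposition ::
  "('g::{finite,ab_group_add} \<Rightarrow> 's::finite operator) \<Rightarrow> 'g \<Rightarrow> 'g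
     \<Rightarrow> (real \<Rightarrow> ('g \<times> 's) operator) \<Rightarrow> (nat \<Rightarrow> real) \<Rightarrow> bool" where
  "invariant_decomposition U gi gj \<rho> t \<longleftrightarrow>
     (\<exists>m n p q \<sigma> \<tau> Y Z.
        prob_weights m p \<and> (\<forall>A<m. pure_state (\<sigma> A) \<and> unitary (Y A)) \<and>
        (\<forall>a\<in>{0, 1}.
           prob_weights n (q a) \<and> (\<forall>B<n. pure_state (\<tau> a B) \<and> unitary (Z a B)) \<and>
           \<rho> (t a) = (\<Sum>A<m. \<Sum>B<n. (p A * q a B) *\<^sub>R tensor (\<sigma> A) (\<tau> a B)) \<and>
           (\<forall>A<m. \<forall>B<n.
              tensor (\<sigma> A) (\<tau> a B) \<in> invariant_algebra U gi gj (tensor (Y A) (Z a B)))))"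

end

theory Submission
  imports Defs
begin

text \<open>
  If the global state is a product with constant frame factor at both times and in both
  perspectives, every relative entropy involved is of the form \<open>S[R\<parallel>R]\<close>, so production and flow
  vanish; for states in the invariant algebras this product form carries over to the other
  perspective because the frame change acts on them as a bilocal unitary, and in case (ii) it does
  so on each component of the mixture. Conversely, for a pure history,
  production zero makes the relative entropy of the frame states finite. Since the initial frame
  state is pure, this support condition alone fixes the later frame state and makes the later global
  state factorise. Applying this in both perspectives and choosing local
  unitaries that map each pure factor to its counterpart yields \<open>Y\<close> and \<open>Z\<close>. The spectral theorem
  is needed only to see that the evolution is unitary.
\<close>

section \<open>Inner products, adjoints and outer products\<close>

lemma cinner_add_right: "cinner u (v + w) = cinner u v + cinner u w"
  by (simp add: cinner_def sum.distrib algebra_simps)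

lemma cinner_scale_right: "cinner u (c *s v) = c * cinner u v"
  by (simp add: cinner_def sum_distrib_left mult_ac)

lemma cnj_cinner: "cnj (cinner u v) = cinner v u"
  by (simp add: cinner_def mult.commute)

lemma cinner_add_left: "cinner (u + v) w = cinner u w + cinner v w"
  by (simp add: cinner_def sum.distrib algebra_simps)

lemma cinner_scale_left: "cinner (c *s u) v = cnj c * cinner u v"
  by (simp add: cinner_def sum_distrib_left mult_ac)

lemma cinner_diff_right: "cinner u (v - w) = cinner u v - cinner u w"
  by (simp add: cinner_def sum_subtractf algebra_simps)

lemma cinner_diff_left: "cinner (u - v) w = cinner u w - cinner v w"
  by (simp add: cinner_def sum_subtractf algebra_simps)

lemma cinner_zero_left [simp]: "cinner 0 u = 0"
  by (simp add: cinner_def)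

lemma cinner_zero_right [simp]: "cinner u 0 = 0"
  by (simp add: cinner_def)

lemma inner_eq_Re_cinner: "u \<bullet> v = Re (cinner u v)"
  by (simp add: inner_vec_def cinner_def inner_complex_def)

lemma cinner_self: "cinner v v = complex_of_real ((norm v)\<^sup>2)"
proof -
  have "cinner v v = complex_of_real (\<Sum>i\<in>UNIV. (cmod (v $ i))\<^sup>2)"
    by (simp only: cinner_def of_real_sum complex_norm_square) (simp add: mult.commute)
  also have "(\<Sum>i\<in>UNIV. (cmod (v $ i))\<^sup>2) = (norm v)\<^sup>2"
    by (simp add: norm_vec_def L2_set_def sum_nonneg)
  finally show ?thesis .
qed

lemma cinner_self_eq_1_iff: "cinner v v = 1 \<longleftrightarrow> norm v = 1"
  using power2_eq_1_iff[of "norm v"] norm_ge_zero[of v]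
  by (auto simp: cinner_self simp flip: of_real_power)

lemma cinner_self_eq_0_iff [simp]: "cinner v v = 0 \<longleftrightarrow> v = 0"
  by (simp add: cinner_self)

section \<open>Adjoints and unitary matrices\<close>

lemma cinner_adj_left: "cinner (adj A *v v) w = cinner v (A *v w)"
  by (simp add: cinner_def adj_def matrix_vector_mult_def sum_distrib_left sum_distrib_right,
      subst sum.swap, simp add: mult_ac)

lemma adj_adj [simp]: "adj (adj A) = A"
  by (simp add: adj_def vec_eq_iff)

text \<open>A one-sided inverse of a square matrix is two-sided, so an isometry is already
  unitary.\<close>

lemma unitaryI: "adj W ** W = mat 1 \<Longrightarrow> unitary W"
  by (simp add: unitary_def matrix_left_right_inverse)

lemma unitary_adj: "unitary W \<Longrightarrow> unitary (adj W)"
  by (simp add: unitary_def)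

lemma cinner_matrix_eqI:
  assumes "\<And>v w. cinner v (A *v w) = cinner v (B *v w)"
  shows "A = B"
proof -
  have "A *v w = B *v w" for w
  proof -
    have "cinner (A *v w - B *v w) (A *v w - B *v w) = 0"
      by (subst cinner_diff_right) (simp add: assms)
    then show ?thesis by simp
  qed
  then show ?thesis by (simp add: matrix_eq)
qed

lemma unitary_iff_cinner: "unitary W \<longleftrightarrow> (\<forall>v w. cinner (W *v v) (W *v w) = cinner v w)"
proof
  assume "unitary W"
  then have "adj W *v (W *v w) = w" for w
    by (simp add: matrix_vector_mul_assoc unitary_def)
  then show "\<forall>v w. cinner (W *v v) (W *v w) = cinner v w"
    by (metis adj_adj cinner_adj_left)
next
  assume *: "\<forall>v w. cinner (W *v v) (W *v w) = cinner v w"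
  have "adj W ** W = mat 1"
    by (rule cinner_matrix_eqI)
       (metis * adj_adj cinner_adj_left matrix_vector_mul_assoc matrix_vector_mul_lid)
  then show "unitary W" by (rule unitaryI)
qed

lemma norm_unitary: "unitary W \<Longrightarrow> norm v = 1 \<Longrightarrow> norm (W *v v) = 1"
  by (metis unitary_iff_cinner cinner_self_eq_1_iff)

lemma outer_mult_vec: "outer u v *v w = cinner v w *s u"
  by (simp add: outer_def cinner_def vec_eq_iff matrix_vector_mult_def sum_distrib_right
      sum_distrib_left mult_ac)

lemma conj_by_outer: "conj_by W (outer u v) = outer (W *v u) (W *v v)"
  by (simp add: conj_by_def outer_def adj_def vec_eq_iff matrix_vector_mult_def
      matrix_matrix_mult_def sum_distrib_right sum_distrib_left mult_ac)

lemma trace_outer: "trace (outer u v) = cinner v u"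
  by (simp add: trace_def outer_def cinner_def mult.commute)

text \<open>Mixtures carry real weights, so real linearity lets the frame change act on each
  component separately.\<close>

lemma linear_conj_by: "linear (conj_by W)"
  by (rule linearI)
     (simp_all add: conj_by_def vec_eq_iff matrix_matrix_mult_def sum.distrib algebra_simps
       sum_distrib_left sum_distrib_right scaleR_sum_right)

lemma trace_conj_by: "unitary W \<Longrightarrow> trace (conj_by W A) = trace A"
  unfolding conj_by_def
  by (subst trace_mul_sym) (simp add: matrix_mul_assoc unitary_def)

text \<open>Unitaries act transitively on unit vectors. Only the projectors have to match, so the
  image of \<open>u\<close> may differ from \<open>v\<close> by a phase, and this freedom lets a
  single reflection do the job.\<close>

lemma unitary_outer_exists:
  assumes "norm u = 1" "norm v = 1"
  obtains W where "unitary W" "conj_by W (outer u u) = outer v v"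
proof -
  define c where "c = cinner v u"
  define \<omega> where "\<omega> = (if c = 0 then 1 else c / cmod c)"
  have cc: "c * cnj c = complex_of_real ((cmod c)\<^sup>2)"
    by (simp only: complex_norm_square)
  have \<omega>: "cnj \<omega> * \<omega> = 1" and \<omega>c: "cnj \<omega> * c = cmod c"
    using cc by (auto simp: \<omega>_def mult.commute power2_eq_square)
  \<comment> \<open>Householder reflection exchanging \<open>u\<close> with a multiple of \<open>v\<close> whose inner product with \<open>u\<close>
    is real. If \<open>w = 0\<close> then \<open>2 / N = 0\<close> and the reflection is the identity.\<close>
  define w where "w = u - \<omega> *s v"
  define N where "N = cinner w w"
  define W where "W = mat 1 - (\<chi> i j. (2 / N) * outer w w $ i $ j)"
  have uu: "cinner u u = 1" "cinner v v = 1"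
    using assms by (simp_all add: cinner_self_eq_1_iff)
  have uv: "cinner (\<omega> *s v) u = cmod c" "cinner u (\<omega> *s v) = cmod c"
    using \<omega>c cnj_cinner[of "\<omega> *s v" u] by (auto simp: cinner_scale_left simp flip: c_def)
  have "cinner (\<omega> *s v) (\<omega> *s v) = 1"
    using \<omega> uu by (simp add: cinner_scale_left cinner_scale_right mult_ac)
  \<comment> \<open>The phase \<open>\<omega>\<close> makes \<open>cinner w u\<close> real and equal
    to \<open>N / 2\<close>, so that the reflection subtracts exactly \<open>w\<close> from
    \<open>u\<close>.\<close>
  then have N: "N = 2 * (1 - cmod c)" and wu: "cinner w u = 1 - cmod c"
    by (simp_all add: N_def w_def cinner_diff_left cinner_diff_right uu uv)
  have Wx: "W *v x = x - (2 / N * cinner w x) *s w" for x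
  proof -
    have "(\<chi> i j. (2 / N) * outer w w $ i $ j) *v x = (2 / N) *s (outer w w *v x)"
      by (simp add: vec_eq_iff matrix_vector_mult_def sum_distrib_left mult_ac)
    then show ?thesis
      by (simp add: W_def matrix_vector_mult_diff_rdistrib outer_mult_vec vec.scale_scale)
  qed
  have Nr: "cnj N = N" by (simp add: N)
  have "adj W = W"
    unfolding vec_eq_iff
    by (simp add: adj_def W_def outer_def Nr mat_def mult_ac)
  moreover have "W *v (W *v x) = x" for x
  proof (cases "N = 0")
    case False
    have "cinner w (W *v x) = - cinner w x"
      using False by (simp add: Wx cinner_diff_right cinner_scale_right flip: N_def)
    then show ?thesis
      by (simp add: Wx[of "W *v x"]) (simp add: Wx)
  qed (simp add: Wx)
  then have "W ** W = mat 1"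
    by (simp add: matrix_eq flip: matrix_vector_mul_assoc)
  ultimately have "unitary W" by (simp add: unitaryI)
  moreover have Wu: "W *v u = \<omega> *s v"
  proof (cases "N = 0")
    case True
    then have "w = 0" by (simp add: N_def)
    then show ?thesis by (simp add: Wx w_def)
  next
    case False
    then have "2 / N * cinner w u = 1" by (simp add: N wu)
    then show ?thesis by (simp add: Wx w_def)
  qed
  have "conj_by W (outer u u) = outer v v"
  proof -
    have "\<omega> * v $ i * (cnj \<omega> * cnj (v $ j)) = (cnj \<omega> * \<omega>) * (v $ i * cnj (v $ j))" for i j
      by (simp add: mult_ac)
    then show ?thesis
      unfolding conj_by_outer Wu by (simp add: outer_def vec_eq_iff \<omega>)
  qed
  ultimately show ?thesis by (rule that)
qed

section \<open>Functional calculus and unitary evolution\<close>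

text \<open>The quadratic form of \<open>f\<close> attains its maximum \<open>m\<close> on the unit
  sphere of \<open>W\<close> at some \<open>v\<close>. The form of \<open>g = m - f\<close> is then
  nonnegative on \<open>W\<close> and vanishes at \<open>v\<close>, which forces
  \<open>g v = 0\<close>.\<close>

lemma self_adjoint_eigenvector:
  fixes f :: "'a::euclidean_space \<Rightarrow> 'a"
  assumes "linear f" and sym: "\<And>x y. f x \<bullet> y = x \<bullet> f y"
    and "subspace W" "f ` W \<subseteq> W" "\<exists>x\<in>W. x \<noteq> 0"
  obtains m v where "v \<in> W" "v \<noteq> 0" "f v = m *\<^sub>R v"
proof -
  interpret linear f by fact
  let ?S = "sphere 0 1 \<inter> W"
  have "compact ?S"
    using \<open>subspace W\<close> by (intro compact_Int_closed closed_subspace) auto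
  moreover have "?S \<noteq> {}"
  proof -
    obtain x where "x \<in> W" "x \<noteq> 0" using assms by auto
    then have "x /\<^sub>R norm x \<in> ?S" using \<open>subspace W\<close> by (auto intro: subspace_scale)
    then show ?thesis by blast
  qed
  moreover have "continuous_on ?S (\<lambda>x. x \<bullet> f x)"
    using \<open>linear f\<close> by (intro continuous_intros linear_continuous_on) (simp add: linear_conv_bounded_linear)
  ultimately obtain v where v: "v \<in> ?S" and max: "\<And>x. x \<in> ?S \<Longrightarrow> x \<bullet> f x \<le> v \<bullet> f v"
    by (metis continuous_attains_sup)
  define m where "m = v \<bullet> f v"
  define g where "g x = m *\<^sub>R x - f x" for x
  have nn: "0 \<le> x \<bullet> g x" if "x \<in> W" for x
  proof (cases "x = 0")
    case False
    then have "x /\<^sub>R norm x \<in> ?S" using \<open>subspace W\<close> that by (auto intro: subspace_scale)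
    from max[OF this] have "(x \<bullet> f x) / (norm x)\<^sup>2 \<le> m"
      by (simp add: m_def scale power2_eq_square divide_simps)
    then have "x \<bullet> f x \<le> m * (norm x)\<^sup>2" using False by (simp add: divide_simps)
    then show ?thesis by (simp add: g_def inner_diff_right power2_norm_eq_inner)
  qed (simp add: g_def zero)
  have "v \<in> W" "v \<bullet> v = 1" using v by (auto simp: norm_eq_1)
  define w where "w = g v"
  have "w \<in> W"
    using \<open>v \<in> W\<close> assms by (auto simp: w_def g_def intro!: subspace_diff subspace_scale)
  have "v \<bullet> g v = 0" by (simp add: g_def inner_diff_right \<open>v \<bullet> v = 1\<close> m_def)
  define K where "K = w \<bullet> g w"
  have "K \<ge> 0" unfolding K_def by (rule nn) fact
  define N where "N = w \<bullet> w"
  \<comment> \<open>Moving from \<open>v\<close> in direction \<open>w = g v\<close> changes the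
    form to \<open>s * (2 * N + s * K)\<close>. This \<open>s\<close> makes the value negative
    unless \<open>N = 0\<close>; the \<open>+ 1\<close> guards against \<open>K = 0\<close>.\<close>
  define s where "s = - N / (K + 1)"
  have "v \<bullet> g w = N"
    by (simp add: N_def w_def g_def inner_diff_right inner_diff_left scale diff sym
        inner_commute algebra_simps)
  moreover have "w \<bullet> g v = N" by (simp add: N_def w_def)
  moreover have "g (v + s *\<^sub>R w) = g v + s *\<^sub>R g w"
    by (simp add: g_def add scale algebra_simps)
  ultimately have "(v + s *\<^sub>R w) \<bullet> g (v + s *\<^sub>R w) = s * (2 * N + s * K)"
    using \<open>v \<bullet> g v = 0\<close> by (simp add: inner_add_left inner_add_right K_def algebra_simps)
  moreover have "v + s *\<^sub>R w \<in> W"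
    using \<open>v \<in> W\<close> \<open>w \<in> W\<close> assms by (auto intro!: subspace_add subspace_scale)
  ultimately have pos: "0 \<le> s * (2 * N + s * K)" using nn by metis
  have "N = 0"
  proof (rule ccontr)
    assume "N \<noteq> 0"
    then have "N > 0" by (simp add: N_def)
    have "s < 0" using \<open>N > 0\<close> \<open>K \<ge> 0\<close> by (simp add: s_def divide_neg_pos)
    moreover have "s * K \<ge> - N"
      using \<open>N > 0\<close> \<open>K \<ge> 0\<close> by (simp add: s_def divide_simps algebra_simps)
    ultimately have "s * (2 * N + s * K) < 0" using \<open>N > 0\<close> by (intro mult_neg_pos) auto
    then show False using pos by simp
  qed
  then have "f v = m *\<^sub>R v" by (simp add: N_def w_def g_def)
  moreover have "v \<noteq> 0" using \<open>v \<bullet> v = 1\<close> by auto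
  ultimately show ?thesis using \<open>v \<in> W\<close> that by blast
qed

lemma hermitian_cinner: "hermitian H \<Longrightarrow> cinner (H *v v) w = cinner v (H *v w)"
  by (metis cinner_adj_left hermitian_def)

lemma scaleR_eq_scale: "r *\<^sub>R v = complex_of_real r *s (v :: complex^'n)"
  unfolding vec_eq_iff vector_scaleR_component vector_smult_component
  by (simp add: scaleR_conv_of_real)

text \<open>The orthogonal complement of the span is invariant under \<open>H\<close>. Were it
  nonzero, it would contain an eigenvector, which also lies in the span and hence is orthogonal to
  itself.\<close>

lemma hermitian_span_eigenvectors:
  assumes "hermitian H"
  shows "vec.span {v. \<exists>c. H *v v = c *s v} = UNIV"
proof (rule ccontr)
  let ?E = "vec.span {v. \<exists>c. H *v v = c *s v}"
  assume "?E \<noteq> UNIV"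
  \<comment> \<open>The complex span is viewed as a real subspace, and orthogonality below is that
    of the real inner product, so that the Euclidean results apply.\<close>
  have sub: "subspace ?E"
    by (auto simp: subspace_def vec.span_zero vec.span_add vec.span_scale scaleR_eq_scale)
  have HE: "H *v y \<in> ?E" if "y \<in> ?E" for y
    using that
  proof (induction rule: vec.span_induct_alt)
    case (step c x y)
    then obtain d where "H *v x = d *s x" by auto
    then have "H *v (c *s x + y) = (c * d) *s x + H *v y"
      by (simp add: vec.add vec.scale)
    with step show ?case by (auto intro: vec.span_add vec.span_scale vec.span_base)
  qed (simp add: vec.span_zero)
  have "span ?E = ?E" using sub by (simp only: span_eq_iff)
  then obtain a where a: "a \<noteq> 0" "\<forall>x\<in>?E. a \<bullet> x = 0"
    using span_not_UNIV_orthogonal[of ?E] \<open>?E \<noteq> UNIV\<close> unfolding \<open>span ?E = ?E\<close> by blast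
  define W where "W = {a. \<forall>x\<in>?E. a \<bullet> x = 0}"
  have sym: "(H *v x) \<bullet> y = x \<bullet> (H *v y)" for x y
    by (simp add: inner_eq_Re_cinner hermitian_cinner assms)
  have "subspace W" by (auto simp: W_def subspace_def inner_add_left)
  moreover have "(*v) H ` W \<subseteq> W" by (auto simp: W_def sym HE)
  moreover have "\<exists>x\<in>W. x \<noteq> 0" using a by (auto simp: W_def)
  ultimately obtain m v where v: "v \<in> W" "v \<noteq> 0" "H *v v = m *\<^sub>R v"
    by (rule self_adjoint_eigenvector[OF matrix_vector_mul_linear sym])
  then have "v \<in> ?E" by (auto simp: scaleR_eq_scale intro!: vec.span_base)
  then have "v \<bullet> v = 0" using v(1) by (simp add: W_def)
  then show False using v by simp
qed

lemma hermitian_eigenvalue_real: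
  assumes "hermitian H" "H *v v = c *s v" "v \<noteq> 0"
  shows "cnj c = c"
  using hermitian_cinner[OF assms(1), of v v] assms(2,3)
  by (simp add: cinner_scale_left cinner_scale_right)

lemma hermitian_eigenvectors_orthogonal:
  assumes "hermitian H" "H *v v = c *s v" "H *v w = d *s w" "c \<noteq> d"
  shows "cinner v w = 0"
proof (cases "v = 0")
  case False
  then have "c * cinner v w = d * cinner v w"
    using hermitian_cinner[OF assms(1), of v w] assms hermitian_eigenvalue_real[OF assms(1,2)]
    by (simp add: cinner_scale_left cinner_scale_right)
  then show ?thesis using assms(4) by simp
qed simp

text \<open>This justifies the definite description in \<open>op_fun\<close>: prescribing the values
  on a basis of eigenvectors gives existence, and agreement on that basis gives uniqueness.\<close>

lemma op_fun_eigenvector: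
  assumes "hermitian H" "H *v v = c *s v"
  shows "op_fun f H *v v = f (Re c) *s v"
proof -
  let ?E = "{v. \<exists>c. H *v v = c *s v}"
  let ?P = "\<lambda>B. \<forall>c v. H *v v = c *s v \<longrightarrow> B *v v = f (Re c) *s v"
  obtain S where S: "S \<subseteq> ?E" "vec.independent S" "?E \<subseteq> vec.span S"
    by (rule vec.maximal_independent_subset)
  then have spS: "vec.span S = UNIV"
    using hermitian_span_eigenvectors[OF assms(1)]
    using vec.span_minimal[OF S(3) vec.subspace_span] by auto
  have "finite S" using S(2) by (rule vec.finiteI_independent)
  obtain e where e: "\<And>b. b \<in> S \<Longrightarrow> H *v b = e b *s b" using S(1) unfolding subset_iff mem_Collect_eq by metis
  obtain g where g: "Vector_Spaces.linear (*s) (*s) g" "\<And>b. b \<in> S \<Longrightarrow> g b = f (Re (e b)) *s b"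
    using vec.linear_independent_extend[OF S(2), of "\<lambda>b. f (Re (e b)) *s b"] by auto
  have gB: "matrix g *v b = f (Re (e b)) *s b" if "b \<in> S" for b
    using matrix_works[OF g(1)] g(2) that by simp
  have ex: "?P (matrix g)"
  proof (intro allI impI)
    fix c v assume v: "H *v v = c *s v"
    have "v \<in> vec.span S" by (simp add: spS)
    then obtain u where u: "v = (\<Sum>b\<in>S. u b *s b)"
      using vec.span_finite[OF \<open>finite S\<close>] by auto
    \<comment> \<open>By independence, only basis vectors with eigenvalue \<open>c\<close> can occur
      in the expansion of an eigenvector for \<open>c\<close>.\<close>
    have "(\<Sum>b\<in>S. (u b * (e b - c)) *s b) = H *v v - c *s v"
      by (simp add: u vec.sum vec.scale e vec.scale_sum_right vec.scale_scale right_diff_distrib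
          vec.scale_left_diff_distrib sum_subtractf mult.commute)
    then have "(\<Sum>b\<in>S. (u b * (e b - c)) *s b) = 0" using v by simp
    then have 0: "u b * (e b - c) = 0" if "b \<in> S" for b
      using vec.independentD[OF S(2) \<open>finite S\<close> order_refl] that by metis
    have "matrix g *v v = (\<Sum>b\<in>S. (u b * f (Re (e b))) *s b)"
      by (simp add: u vec.sum vec.scale gB vec.scale_scale)
    also have "\<dots> = (\<Sum>b\<in>S. (f (Re c) * u b) *s b)"
    proof (rule sum.cong)
      fix b assume "b \<in> S"
      with 0[of b] have "u b = 0 \<or> e b = c" by auto
      then show "(u b * f (Re (e b))) *s b = (f (Re c) * u b) *s b" by auto
    qed simp
    also have "\<dots> = f (Re c) *s v" by (simp add: u vec.scale_sum_right vec.scale_scale)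
    finally show "matrix g *v v = f (Re c) *s v" .
  qed
  have uniq: "B = matrix g" if "?P B" for B
  proof -
    have "B *v v = matrix g *v v" for v
    proof -
      have "v \<in> vec.span S" by (simp add: spS)
      then show ?thesis
      proof (induction rule: vec.span_induct_alt)
        case (step c x y)
        then have "B *v x = f (Re (e x)) *s x" using that e by blast
        then show ?case using step by (simp add: vec.add vec.scale gB)
      qed simp
    qed
    then show ?thesis by (simp add: matrix_eq)
  qed
  have "op_fun f H = matrix g" unfolding op_fun_def using ex uniq by (rule the_equality)
  then show ?thesis using ex assms(2) by simp
qed

text \<open>Inner products of eigenvectors are preserved: the phases cancel for equal eigenvalues,
  and both sides vanish for distinct ones. Spanning extends this to the second argument, then to the
  first.\<close>

lemma op_fun_unitary:
  assumes "hermitian H" "\<And>x. cmod (f x) = 1"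
  shows "unitary (op_fun f H)"
proof -
  let ?B = "op_fun f H" and ?E = "{v. \<exists>c. H *v v = c *s v}"
  have f: "cnj (f x) * f x = 1" for x
    using assms(2)[of x] complex_norm_square[of "f x"] by (simp add: mult.commute)
  have E: "cinner (?B *v v) (?B *v w) = cinner v w" if "v \<in> ?E" "w \<in> ?E" for v w
  proof -
    obtain c d where cd: "H *v v = c *s v" "H *v w = d *s w" using \<open>v \<in> ?E\<close> \<open>w \<in> ?E\<close> by auto
    then have "cinner (?B *v v) (?B *v w) = cnj (f (Re c)) * f (Re d) * cinner v w"
      by (simp add: op_fun_eigenvector[OF assms(1) cd(1)] op_fun_eigenvector[OF assms(1) cd(2)]
          cinner_scale_left cinner_scale_right)
    then show ?thesis
      using hermitian_eigenvectors_orthogonal[OF assms(1) cd] f by (cases "c = d") auto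
  qed
  have left: "cinner (?B *v v) (?B *v w) = cinner v w" if "v \<in> ?E" for v w
  proof -
    have "w \<in> vec.span ?E" by (simp add: hermitian_span_eigenvectors assms)
    then show ?thesis
      by (induction rule: vec.span_induct_alt)
         (simp_all add: vec.add vec.scale cinner_add_right cinner_scale_right E[OF that])
  qed
  have "cinner (?B *v v) (?B *v w) = cinner v w" for v w
  proof -
    have "v \<in> vec.span ?E" by (simp add: hermitian_span_eigenvectors assms)
    then show ?thesis
      by (induction rule: vec.span_induct_alt)
         (simp_all add: vec.add vec.scale cinner_add_left cinner_scale_left left)
  qed
  then show ?thesis by (simp add: unitary_iff_cinner)
qed

lemma unitary_evolution: "hermitian H \<Longrightarrow> unitary (evolution H t)"
  unfolding evolution_def by (rule op_fun_unitary) simp_all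

section \<open>Tensor products and partial traces\<close>

lemma sum_UNIV_prod: "(\<Sum>p\<in>UNIV. f p) = (\<Sum>a\<in>UNIV. \<Sum>b\<in>UNIV. f (a, b))"
  by (simp add: sum.cartesian_product' flip: UNIV_Times_UNIV)

lemma tensor_mult: "tensor A B ** tensor C D = tensor (A ** C) (B ** D)"
  by (simp add: tensor_def vec_eq_iff matrix_matrix_mult_def sum_UNIV_prod sum_product mult_ac)

lemma adj_tensor: "adj (tensor A B) = tensor (adj A) (adj B)"
  by (simp add: tensor_def adj_def vec_eq_iff)

lemma conj_by_tensor: "conj_by (tensor Y Z) (tensor A B) = tensor (conj_by Y A) (conj_by Z B)"
  by (simp add: conj_by_def adj_tensor tensor_mult)

lemma ptrace_system_tensor: "ptrace_system (tensor A B) = (\<chi> g h. A $ g $ h * trace B)"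
  by (simp add: ptrace_system_def tensor_def trace_def vec_eq_iff sum_distrib_left)

lemma ptrace_frame_tensor: "ptrace_frame (tensor A B) = (\<chi> r s. trace A * B $ r $ s)"
  by (simp add: ptrace_frame_def tensor_def trace_def vec_eq_iff sum_distrib_right)

lemma ptrace_system_tensor_1 [simp]: "trace B = 1 \<Longrightarrow> ptrace_system (tensor A B) = A"
  by (simp add: ptrace_system_tensor vec_eq_iff)

lemma ptrace_frame_tensor_1 [simp]: "trace A = 1 \<Longrightarrow> ptrace_frame (tensor A B) = B"
  by (simp add: ptrace_frame_tensor vec_eq_iff)

lemma trace_ptrace_system: "trace (ptrace_system R) = trace R"
  by (simp add: trace_def ptrace_system_def sum_UNIV_prod)

lemma trace_ptrace_frame: "trace (ptrace_frame R) = trace R"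
  by (simp add: trace_def ptrace_frame_def sum_UNIV_prod, subst sum.swap, simp)

lemma trace_sum: "trace (\<Sum>x\<in>S. f x) = (\<Sum>x\<in>S. trace (f x))"
  unfolding trace_def by (subst sum.swap) simp

lemma trace_scaleR: "trace (r *\<^sub>R A) = r *\<^sub>R trace A"
  by (simp add: trace_def scaleR_sum_right)

lemma trace_mixture:
  "(\<Sum>k<n. p k) = 1 \<Longrightarrow> (\<And>k. k < n \<Longrightarrow> trace (\<sigma> k) = 1) \<Longrightarrow>
    trace (\<Sum>k<n. p k *\<^sub>R \<sigma> k) = (1 :: complex)"
  by (simp add: trace_sum trace_scaleR flip: scaleR_sum_left)

text \<open>Weights of the form \<open>p A * q B\<close> factorise, so such a mixture of products is
  itself a product.\<close>

lemma tensor_sum_sum: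
  "tensor (\<Sum>A\<in>S. p A *\<^sub>R \<sigma> A) (\<Sum>B\<in>T. q B *\<^sub>R \<tau> B) =
    (\<Sum>A\<in>S. \<Sum>B\<in>T. (p A * q B) *\<^sub>R tensor (\<sigma> A) (\<tau> B))"
  by (simp add: tensor_def vec_eq_iff sum_product mult.commute)

lemma tensor_outer:
  "tensor (outer a a) (outer b b) = outer (\<chi> p. a $ fst p * b $ snd p) (\<chi> p. a $ fst p * b $ snd p)"
  by (simp add: tensor_def outer_def vec_eq_iff mult_ac)

lemma norm_tensor_vec: "norm (\<chi> p. (a :: complex^'a) $ fst p * (b :: complex^'b) $ snd p) = norm a * norm b"
proof -
  have "(norm (\<chi> p. a $ fst p * b $ snd p))\<^sup>2 = (norm a * norm b)\<^sup>2"
    by (simp add: norm_vec_def L2_set_def sum_nonneg power_mult_distrib sum_UNIV_prod sum_product norm_mult)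
  then show ?thesis by (simp add: power2_eq_iff_nonneg)
qed

section \<open>Pure product states\<close>

lemma trace_pure_state: "pure_state R \<Longrightarrow> trace R = 1"
  by (auto simp: pure_state_def trace_outer cinner_self_eq_1_iff)

text \<open>A nonzero entry of \<open>v\<close> serves as a pivot: one column of
  \<open>outer v v\<close> is a multiple of \<open>v\<close>, and the product form splits that
  column into a frame and a system vector.\<close>

lemma pure_product_state:
  assumes "norm v = 1" "product_state (outer v v)"
  obtains a b where "norm a = 1" "norm b = 1" "outer v v = tensor (outer a a) (outer b b)"
proof -
  have "v \<noteq> 0" using assms(1) by auto
  then obtain h r where hr: "v $ (h, r) \<noteq> 0" by (auto simp: vec_eq_iff)
  define A where "A = ptrace_system (outer v v)"
  define B where "B = ptrace_frame (outer v v)"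
  \<comment> \<open>The column of \<open>A\<close> at the pivot, divided by the factor that the
    pivot contributes to \<open>outer v v\<close>.\<close>
  define a where "a = (\<chi> g. A $ g $ h / cnj (v $ (h, r)))"
  define b where "b = (\<chi> s. B $ s $ r)"
  have eq: "outer v v = tensor A B" using assms(2) by (simp add: product_state_def A_def B_def)
  have v: "v = (\<chi> p. a $ fst p * b $ snd p)"
  proof -
    have "v $ (g, s) * cnj (v $ (h, r)) = A $ g $ h * B $ s $ r" for g s
      using arg_cong[OF eq, of "\<lambda>M. M $ (g, s) $ (h, r)"] by (simp add: outer_def tensor_def)
    then have "v $ (g, s) = a $ g * b $ s" for g s
      using hr by (simp add: a_def b_def divide_simps)
    then show ?thesis by (simp add: vec_eq_iff)
  qed
  have n: "norm a * norm b = 1"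
    using assms(1) by (subst (asm) v) (simp only: norm_tensor_vec)
  \<comment> \<open>The norms of \<open>a\<close> and \<open>b\<close> have product 1, so scaling
    each vector by the norm of the other normalises both and leaves the tensor product
    unchanged.\<close>
  define a' b' where "a' = norm b *\<^sub>R a" and "b' = norm a *\<^sub>R b"
  have "(\<chi> p. a' $ fst p * b' $ snd p) = v"
  proof -
    have "a' $ g * b' $ s = (norm a * norm b) *\<^sub>R (a $ g * b $ s)" for g s
      by (simp add: a'_def b'_def)
    then show ?thesis by (subst v) (simp add: n vec_eq_iff)
  qed
  then have "outer v v = tensor (outer a' a') (outer b' b')"
    by (simp only: tensor_outer)
  moreover have "norm a' = 1" "norm b' = 1" using n by (simp_all add: a'_def b'_def mult.commute)
  ultimately show ?thesis by (intro that)
qed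

text \<open>
  A finite relative entropy confines the support of the reduced state to the line spanned by \<open>a\<close>,
  which forces the whole pure state to factorise.
\<close>

lemma pure_state_factorises:
  fixes w :: "complex^('g::finite \<times> 's::finite)"
  assumes "norm w = 1" "norm a = 1"
    and fin: "rel_entropy (ptrace_system (outer w w)) (outer a a) \<noteq> \<infinity>"
  obtains b where "norm b = 1" "outer w w = tensor (outer a a) (outer b b)"
proof -
  let ?R = "ptrace_system (outer w w)"
  \<comment> \<open>Slices of \<open>w\<close> at fixed system index; the reduced frame state is the
    sum of their \<open>outer\<close> squares.\<close>
  define ws where "ws s = (\<chi> g. w $ (g, s))" for s
  have supp: "?R *v x = 0" if "cinner a x = 0" for x
  proof -
    have "outer a a *v x = 0" using that by (simp add: outer_mult_vec)
    then show ?thesis using fin by (auto simp: rel_entropy_def split: if_splits)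
  qed
  have R: "cinner x (?R *v x) = (\<Sum>s\<in>UNIV. complex_of_real ((cmod (cinner (ws s) x))\<^sup>2))" for x
  proof -
    have "?R = (\<Sum>s\<in>UNIV. outer (ws s) (ws s))"
      by (simp add: ptrace_system_def outer_def ws_def vec_eq_iff)
    then have "?R *v x = (\<Sum>s\<in>UNIV. cinner (ws s) x *s ws s)"
      by (simp add: vec_eq_iff matrix_vector_mult_def outer_def cinner_def sum_distrib_right
          sum_distrib_left mult_ac) (subst sum.swap, simp)
    then have "cinner x (?R *v x) = (\<Sum>s\<in>UNIV. cinner (ws s) x * cinner x (ws s))"
      by (simp add: cinner_def[of x] sum_distrib_left sum_distrib_right mult_ac) (subst sum.swap, simp)
    also have "\<dots> = (\<Sum>s\<in>UNIV. cinner (ws s) x * cnj (cinner (ws s) x))"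
      by (simp add: cnj_cinner)
    finally show ?thesis by (simp only: complex_norm_square)
  qed
  have aa: "cinner a a = 1" using assms by (simp add: cinner_self_eq_1_iff)
  have ws: "ws s = cinner a (ws s) *s a" for s
  proof -
    \<comment> \<open>The part of the slice orthogonal to \<open>a\<close>. The reduced state
      annihilates it, so its overlaps with all slices vanish, and with them its own norm.\<close>
    define x where "x = ws s - cinner a (ws s) *s a"
    have ax: "cinner a x = 0" by (simp add: x_def cinner_diff_right cinner_scale_right aa)
    then have "complex_of_real (\<Sum>s\<in>UNIV. (cmod (cinner (ws s) x))\<^sup>2) = 0"
      using R[of x] supp[of x] by simp
    then have "(\<Sum>s\<in>UNIV. (cmod (cinner (ws s) x))\<^sup>2) = 0" by (simp only: of_real_eq_0_iff)
    then have "cinner (ws s) x = 0" by (simp add: sum_nonneg_eq_0_iff)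
    then have "cinner x x = 0"
      by (subst x_def) (simp add: cinner_diff_left cinner_scale_left ax)
    then show ?thesis by (simp add: x_def)
  qed
  define b where "b = (\<chi> s. cinner a (ws s))"
  have w: "w = (\<chi> p. a $ fst p * b $ snd p)"
  proof -
    have "w $ (g, s) = a $ g * b $ s" for g s
      using arg_cong[OF ws[of s], of "\<lambda>x. x $ g"] by (simp add: b_def mult.commute) (simp add: ws_def)
    then show ?thesis by (simp add: vec_eq_iff)
  qed
  have "norm b = 1"
  proof -
    have "norm w = norm a * norm b" by (subst w) (rule norm_tensor_vec)
    then show ?thesis using assms(1,2) by simp
  qed
  moreover have "outer w w = tensor (outer a a) (outer b b)"
    by (simp only: tensor_outer flip: w)
  ultimately show ?thesis by (intro that)
qed

section \<open>Entropy exchange\<close>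

lemma rel_entropy_self [simp]: "rel_entropy R R = 0"
  by (simp add: rel_entropy_def trace_def)

lemma no_entropy_exchange:
  assumes "\<rho> 0 = tensor \<sigma> \<tau>" "\<rho> t = tensor \<sigma> \<tau>'"
    and "trace \<sigma> = 1" "trace \<tau> = 1" "trace \<tau>' = 1"
  shows "product_state (\<rho> 0)" "entropy_production \<rho> t = 0" "entropy_flow \<rho> t = 0"
  using assms
  by (simp_all add: product_state_def entropy_production_def entropy_flow_def mutual_info_def
      zero_ereal_def)

text \<open>The mutual information is real or \<open>\<infinity>\<close>, so it cannot cancel an
  infinite second summand.\<close>

lemma entropy_production_finite:
  assumes "entropy_production \<rho> t = 0"
  shows "rel_entropy (ptrace_system (\<rho> t)) (ptrace_system (\<rho> 0)) \<noteq> \<infinity>"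
proof
  assume "rel_entropy (ptrace_system (\<rho> t)) (ptrace_system (\<rho> 0)) = \<infinity>"
  moreover have "mutual_info (\<rho> t) \<noteq> -\<infinity>"
    by (simp add: mutual_info_def rel_entropy_def)
  ultimately show False
    using assms by (cases "mutual_info (\<rho> t)") (simp_all add: entropy_production_def)
qed

text \<open>Stated for an arbitrary history so that it applies in each perspective. Having the same
  \<open>a\<close> at both times is what later permits a time-independent \<open>Y\<close>.\<close>

lemma pure_history_factorises:
  assumes "norm v = 1" "norm w = 1" "\<rho> 0 = outer v v" "\<rho> t = outer w w"
    and "product_state (\<rho> 0)" "entropy_production \<rho> t = 0"
  obtains a b c where "norm a = 1" "norm b = 1" "norm c = 1"
    "\<rho> 0 = tensor (outer a a) (outer b b)" "\<rho> t = tensor (outer a a) (outer c c)"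
proof -
  obtain a b where ab: "norm a = 1" "norm b = 1" "\<rho> 0 = tensor (outer a a) (outer b b)"
    using pure_product_state[of v] assms by metis
  then have "ptrace_system (\<rho> 0) = outer a a"
    by (simp add: trace_outer cinner_self_eq_1_iff)
  then have "rel_entropy (ptrace_system (outer w w)) (outer a a) \<noteq> \<infinity>"
    using entropy_production_finite[OF assms(6)] assms(4) by metis
  then show ?thesis
    using pure_state_factorises[OF assms(2) ab(1)] ab that assms(4) by metis
qed

section \<open>Change of frame\<close>

lemma reorientation_eq_frame_change: "reorientation U gi gj = frame_change U gi gj"
  by (simp add: reorientation_def frame_change_def add.commute)

text \<open>The column index \<open>b\<close> selects the single summand
  \<open>g = gj - b\<close>.\<close>

lemma frame_change_nth:
  "frame_change U gi gj $ (a, s) $ (b, r) = (if a = gj - b + gi then U (gj - b) $ s $ r else 0)"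
proof -
  have "frame_change U gi gj $ (a, s) $ (b, r) =
      (\<Sum>g\<in>UNIV. if g = gj - b then if a = gj - b + gi then U (gj - b) $ s $ r else 0 else 0)"
    unfolding frame_change_def sum_component
    by (rule sum.cong) (auto simp: tensor_def ketbra_def outer_def axis_def)
  then show ?thesis by simp
qed

text \<open>The frame indices are permuted by sending \<open>b\<close> to
  \<open>gj - b + gi\<close>, and each block is a unitary \<open>U (gj - b)\<close>; hence the
  columns are orthonormal.\<close>

lemma unitary_frame_change:
  assumes "unitary_rep U"
  shows "unitary (frame_change U gi gj)"
proof (rule unitaryI)
  have U: "(\<Sum>s\<in>UNIV. cnj (U g $ s $ r) * U g $ s $ r') = (if r = r' then 1 else 0)" for g r r'
  proof -
    have "(adj (U g) ** U g) $ r $ r' = mat 1 $ r $ r'"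
      using assms by (simp add: unitary_rep_def unitary_def)
    then show ?thesis by (simp add: adj_def matrix_matrix_mult_def mat_def)
  qed
  let ?V = "frame_change U gi gj"
  have "(adj ?V ** ?V) $ (b, r) $ (b', r') = mat 1 $ (b, r) $ (b', r')" for b r b' r'
  proof -
    have "(adj ?V ** ?V) $ (b, r) $ (b', r') =
        (\<Sum>a\<in>UNIV. \<Sum>s\<in>UNIV. cnj (?V $ (a, s) $ (b, r)) * ?V $ (a, s) $ (b', r'))"
      by (simp add: adj_def matrix_matrix_mult_def sum_UNIV_prod)
    also have "\<dots> = (\<Sum>a\<in>UNIV. if a = gj - b + gi then if b = b' \<and> r = r' then 1 else 0 else 0)"
      by (intro sum.cong refl, cases "b = b'") (auto simp: frame_change_nth U)
    finally show ?thesis by (simp add: mat_def)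
  qed
  then show "adj ?V ** ?V = mat 1" by (simp add: vec_eq_iff)
qed

text \<open>Membership in the algebra trades the global frame change for a bilocal unitary. The
  adjoints stem from the conjugation by \<open>adj X\<close> in
  \<open>invariant_algebra\<close>.\<close>

lemma frame_change_invariant_tensor:
  assumes "tensor A B \<in> invariant_algebra U gi gj (tensor Y Z)"
  shows "conj_by (frame_change U gi gj) (tensor A B) = tensor (conj_by (adj Y) A) (conj_by (adj Z) B)"
  using assms by (simp add: invariant_algebra_def reorientation_eq_frame_change adj_tensor conj_by_tensor)

section \<open>Sufficiency of the invariance conditions\<close>

lemma no_exchangeI:
  assumes "\<rho> 0 = tensor \<sigma> \<tau>" "\<rho> t = tensor \<sigma> \<upsilon>"
    and "trace \<sigma> = 1" "trace \<tau> = 1" "trace \<upsilon> = 1"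
    and "conj_by (frame_change U gi gj) (\<rho> 0) = tensor \<sigma>' \<tau>'"
    and "conj_by (frame_change U gi gj) (\<rho> t) = tensor \<sigma>' \<upsilon>'"
    and "trace \<sigma>' = 1" "trace \<tau>' = 1" "trace \<upsilon>' = 1"
  shows "no_exchange U gi gj \<rho> t"
  using no_entropy_exchange[of \<rho> \<sigma> \<tau> t \<upsilon>]
    no_entropy_exchange[of "other_perspective U gi gj \<rho>" \<sigma>' \<tau>' t \<upsilon>'] assms
  by (simp add: no_exchange_def other_perspective_def Let_def)

text \<open>Since \<open>Y\<close> is common to both times, the frame factor stays constant in the
  other perspective too.\<close>

lemma no_exchange_if_invariant_product:
  assumes "invariant_product U gi gj \<rho> t" "t 0 = 0" "trace (\<rho> 0) = 1" "trace (\<rho> (t 1)) = 1"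
  shows "no_exchange U gi gj \<rho> (t 1)"
proof -
  define \<sigma> where "\<sigma> = ptrace_system (\<rho> 0)"
  define \<tau> where "\<tau> a = ptrace_frame (\<rho> (t a))" for a
  obtain Y Z where Y: "unitary Y" and Z: "\<And>a. a \<in> {0, 1} \<Longrightarrow> unitary (Z a)"
    and \<rho>: "\<And>a. a \<in> {0, 1} \<Longrightarrow> \<rho> (t a) = tensor \<sigma> (\<tau> a)"
    and inv: "\<And>a. a \<in> {0, 1} \<Longrightarrow> \<rho> (t a) \<in> invariant_algebra U gi gj (tensor Y (Z a))"
    using assms(1) unfolding invariant_product_def \<sigma>_def \<tau>_def by metis
  have tr: "trace \<sigma> = 1" "trace (\<tau> 0) = 1" "trace (\<tau> 1) = 1"
    using assms by (simp_all add: \<sigma>_def \<tau>_def trace_ptrace_system trace_ptrace_frame)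
  have \<rho>': "conj_by (frame_change U gi gj) (\<rho> (t a)) =
      tensor (conj_by (adj Y) \<sigma>) (conj_by (adj (Z a)) (\<tau> a))" if "a \<in> {0, 1}" for a
    using inv[OF that] \<rho>[OF that] by (simp add: frame_change_invariant_tensor)
  show ?thesis
    using \<rho>[of 0] \<rho>[of 1] \<rho>'[of 0] \<rho>'[of 1] tr Y Z[of 0] Z[of 1] assms(2)
    by (intro no_exchangeI[where \<sigma> = \<sigma> and \<tau> = "\<tau> 0" and \<upsilon> = "\<tau> 1"
          and \<sigma>' = "conj_by (adj Y) \<sigma>" and \<tau>' = "conj_by (adj (Z 0)) (\<tau> 0)"
          and \<upsilon>' = "conj_by (adj (Z 1)) (\<tau> 1)"])
       (simp_all add: trace_conj_by unitary_adj)
qed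

text \<open>The weights \<open>p\<close>, the states \<open>\<sigma>\<close> and the unitaries
  \<open>Y\<close> are the same at both times, so the mixed frame factor is constant in each
  perspective.\<close>

lemma no_exchange_if_invariant_decomposition:
  assumes "invariant_decomposition U gi gj \<rho> t" "t 0 = 0"
  shows "no_exchange U gi gj \<rho> (t 1)"
proof -
  obtain m n p q \<sigma> \<tau> Y Z where "prob_weights m p \<and> (\<forall>A<m. pure_state (\<sigma> A) \<and> unitary (Y A)) \<and>
        (\<forall>a\<in>{0, 1}.
           prob_weights n (q a) \<and> (\<forall>B<n. pure_state (\<tau> a B) \<and> unitary (Z a B)) \<and>
           \<rho> (t a) = (\<Sum>A<m. \<Sum>B<n. (p A * q a B) *\<^sub>R tensor (\<sigma> A) (\<tau> a B)) \<and>
           (\<forall>A<m. \<forall>B<n.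
              tensor (\<sigma> A) (\<tau> a B) \<in> invariant_algebra U gi gj (tensor (Y A) (Z a B))))"
    using assms(1) unfolding invariant_decomposition_def by auto
  then have
    p: "prob_weights m p" and \<sigma>: "\<And>A. A < m \<Longrightarrow> pure_state (\<sigma> A) \<and> unitary (Y A)"
    and q: "\<And>a. a \<in> {0, 1} \<Longrightarrow> prob_weights n (q a)"
    and \<tau>: "\<And>a B. a \<in> {0, 1} \<Longrightarrow> B < n \<Longrightarrow> pure_state (\<tau> a B) \<and> unitary (Z a B)"
    and \<rho>: "\<And>a. a \<in> {0, 1} \<Longrightarrow>
      \<rho> (t a) = (\<Sum>A<m. \<Sum>B<n. (p A * q a B) *\<^sub>R tensor (\<sigma> A) (\<tau> a B))"
    and inv: "\<And>a A B. a \<in> {0, 1} \<Longrightarrow> A < m \<Longrightarrow> B < n \<Longrightarrow>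
      tensor (\<sigma> A) (\<tau> a B) \<in> invariant_algebra U gi gj (tensor (Y A) (Z a B))"
    by blast+
  define \<sigma>1 where "\<sigma>1 = (\<Sum>A<m. p A *\<^sub>R \<sigma> A)"
  define \<tau>1 where "\<tau>1 a = (\<Sum>B<n. q a B *\<^sub>R \<tau> a B)" for a
  define \<sigma>2 where "\<sigma>2 = (\<Sum>A<m. p A *\<^sub>R conj_by (adj (Y A)) (\<sigma> A))"
  define \<tau>2 where "\<tau>2 a = (\<Sum>B<n. q a B *\<^sub>R conj_by (adj (Z a B)) (\<tau> a B))" for a
  interpret linear "conj_by (frame_change U gi gj)" by (rule linear_conj_by)
  have \<rho>1: "\<rho> (t a) = tensor \<sigma>1 (\<tau>1 a)" if "a \<in> {0, 1}" for a
    unfolding \<rho>[OF that] \<sigma>1_def \<tau>1_def by (simp only: tensor_sum_sum)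
  \<comment> \<open>Each local unitary depends only on the index of its own factor, so the
    transformed double sum splits again.\<close>
  have \<rho>2: "conj_by (frame_change U gi gj) (\<rho> (t a)) = tensor \<sigma>2 (\<tau>2 a)" if "a \<in> {0, 1}" for a
    unfolding \<rho>[OF that] \<sigma>2_def \<tau>2_def tensor_sum_sum sum scale
    by (intro sum.cong refl) (simp add: frame_change_invariant_tensor[OF inv[OF that]])
  have tr: "trace \<sigma>1 = 1" "trace \<sigma>2 = 1"
    "\<And>a. a \<in> {0, 1} \<Longrightarrow> trace (\<tau>1 a) = 1" "\<And>a. a \<in> {0, 1} \<Longrightarrow> trace (\<tau>2 a) = 1"
    unfolding \<sigma>1_def \<sigma>2_def \<tau>1_def \<tau>2_def using p q \<sigma> \<tau>
    by (auto intro!: trace_mixture simp: prob_weights_def trace_pure_state trace_conj_by unitary_adj)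
  show ?thesis
    using \<rho>1[of 0] \<rho>1[of 1] \<rho>2[of 0] \<rho>2[of 1] tr assms(2)
    by (intro no_exchangeI[where \<sigma> = \<sigma>1 and \<tau> = "\<tau>1 0" and \<upsilon> = "\<tau>1 1"
          and \<sigma>' = \<sigma>2 and \<tau>' = "\<tau>2 0" and \<upsilon>' = "\<tau>2 1"]) simp_all
qed

section \<open>Necessity for pure histories\<close>

lemma invariant_product_if_no_exchange:
  assumes "unitary_rep U" "t 0 = 0" "no_exchange U gi gj \<rho> (t 1)"
    and "norm v = 1" "\<rho> 0 = outer v v" "norm w = 1" "\<rho> (t 1) = outer w w"
  shows "invariant_product U gi gj \<rho> t"
proof -
  let ?V = "frame_change U gi gj"
  let ?\<rho> = "other_perspective U gi gj \<rho>"
  have V: "unitary ?V" using assms(1) by (rule unitary_frame_change)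
  have ne: "product_state (\<rho> 0)" "product_state (?\<rho> 0)"
    "entropy_production \<rho> (t 1) = 0" "entropy_production ?\<rho> (t 1) = 0"
    using assms(3) by (simp_all add: no_exchange_def Let_def)
  obtain a b c where n: "norm a = 1" "norm b = 1" "norm c = 1"
    and \<rho>: "\<rho> 0 = tensor (outer a a) (outer b b)" "\<rho> (t 1) = tensor (outer a a) (outer c c)"
    using pure_history_factorises[of v w \<rho> "t 1"] assms ne by metis
  \<comment> \<open>The frame change keeps the states pure, so the factorisation is available in the
    other perspective as well.\<close>
  have "?\<rho> 0 = outer (?V *v v) (?V *v v)" "?\<rho> (t 1) = outer (?V *v w) (?V *v w)"
    by (simp_all only: other_perspective_def assms conj_by_outer)
  then obtain a' b' c' where n': "norm a' = 1" "norm b' = 1" "norm c' = 1"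
    and \<rho>': "?\<rho> 0 = tensor (outer a' a') (outer b' b')" "?\<rho> (t 1) = tensor (outer a' a') (outer c' c')"
    using pure_history_factorises[of "?V *v v" "?V *v w" ?\<rho> "t 1"] assms ne norm_unitary[OF V] by metis
  \<comment> \<open>One \<open>Y\<close> serves both times because \<open>a\<close> and
    \<open>a'\<close> do; the system vectors vary and call for two unitaries.\<close>
  obtain Y where Y: "unitary Y" "conj_by Y (outer a a) = outer a' a'"
    using unitary_outer_exists n n' by metis
  obtain Z0 where Z0: "unitary Z0" "conj_by Z0 (outer b b) = outer b' b'"
    using unitary_outer_exists n n' by metis
  obtain Z1 where Z1: "unitary Z1" "conj_by Z1 (outer c c) = outer c' c'"
    using unitary_outer_exists n n' by metis
  \<comment> \<open>Adjoints are taken because \<open>invariant_algebra\<close> conjugates by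
    \<open>adj X\<close>.\<close>
  define Z where "Z k = adj (if k = (0::nat) then Z0 else Z1)" for k
  show ?thesis
    unfolding invariant_product_def
  proof (intro exI[of _ "adj Y"] exI[of _ Z] conjI ballI)
    show "unitary (adj Y)" using Y by (simp add: unitary_adj)
    fix k :: nat assume k: "k \<in> {0, 1}"
    show "unitary (Z k)" using Z0 Z1 by (simp add: Z_def unitary_adj)
    show "\<rho> (t k) = tensor (ptrace_system (\<rho> 0)) (ptrace_frame (\<rho> (t k)))"
      using k \<rho> assms(2) n by (auto simp: trace_outer cinner_self_eq_1_iff)
    show "\<rho> (t k) \<in> invariant_algebra U gi gj (tensor (adj Y) (Z k))"
      using k \<rho> \<rho>' assms(2) Y Z0 Z1
      by (auto simp: invariant_algebra_def reorientation_eq_frame_change adj_tensor conj_by_tensor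
          Z_def other_perspective_def)
  qed
qed

theorem lemma13:
  fixes U :: "'g::{finite,ab_group_add} \<Rightarrow> 's::finite operator"
    and gi gj :: 'g
    and H :: "('g \<times> 's) operator"
    and \<rho> :: "real \<Rightarrow> ('g \<times> 's) operator"
    and t :: "nat \<Rightarrow> real"
  assumes "CARD('g) > 1"
    and "unitary_rep U"
    and "hermitian H"
    and "density_operator (\<rho> 0)"
    and "\<And>s. \<rho> s = conj_by (evolution H s) (\<rho> 0)"
    and "t 0 = 0" and "t 1 > 0"
  shows "(pure_state (\<rho> 0) \<longrightarrow>
            (no_exchange U gi gj \<rho> (t 1) \<longleftrightarrow> invariant_product U gi gj \<rho> t)) \<and>
         (\<not> pure_state (\<rho> 0) \<longrightarrow>
            invariant_product U gi gj \<rho> t \<or> invariant_decomposition U gi gj \<rho> t \<longrightarrow>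
            no_exchange U gi gj \<rho> (t 1))"
proof -
  let ?E = "evolution H (t 1)"
  have E: "unitary ?E" using assms(3) by (rule unitary_evolution)
  have tr: "trace (\<rho> 0) = 1" using assms(4) by (simp add: density_operator_def)
  \<comment> \<open>Unit trace at both times lets the partial traces recover the tensor
    factors.\<close>
  then have "trace (\<rho> (t 1)) = 1"
    using assms(5)[of "t 1"] trace_conj_by[OF E] by metis
  with tr have "no_exchange U gi gj \<rho> (t 1)" if "invariant_product U gi gj \<rho> t"
    using no_exchange_if_invariant_product that assms(6) by blast
  moreover have "no_exchange U gi gj \<rho> (t 1)" if "invariant_decomposition U gi gj \<rho> t"
    using no_exchange_if_invariant_decomposition that assms(6) by blast
  moreover have "invariant_product U gi gj \<rho> t"
    if "pure_state (\<rho> 0)" and no: "no_exchange U gi gj \<rho> (t 1)"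
  proof -
    obtain v where v: "norm v = 1" "\<rho> 0 = outer v v" using \<open>pure_state (\<rho> 0)\<close> by (auto simp: pure_state_def)
    then have "\<rho> (t 1) = outer (?E *v v) (?E *v v)"
      using assms(5)[of "t 1"] by (simp add: conj_by_outer)
    then show ?thesis
      using invariant_product_if_no_exchange[where t = t, OF assms(2,6) no v norm_unitary[OF E v(1)]]
      by simp
  qed
  ultimately show ?thesis by blast
qed

end
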